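(* For any $\varepsilon>0$ there is $r_0=r_0(\varepsilon)$ such that for all $r\ge r_0$ and for all $k\ge 3$ there exists $n_0=n_0(r,k)$ such that any linear $r$-graph $G$ on $n\ge n_0$ vertices with no $((r-2)k+3,k)$-configuration has $d_{\mathrm{lin}}(G)<\varepsilon$.
   Context: An $r$-graph is a (finite) $r$-uniform hypergraph. An $r$-graph is linear if no two distinct edges intersect in more than one vertex. In an $r$-graph, an $(s,t)$-configuration is a collection of $t$ (distinct) edges which span at most $s$ vertices, i.e. whose union has size at most $s$. For a linear $r$-graph $G$ on $n$ vertices with $e(G)$ edges, its linear density is $d_{\mathrm{lin}}(G)=e(G)\binom{r}{2}/\binom{n}{2}$. *)

theory Defs
  imports Complex_Main
begin

text \<open>A hypergraph is given by its vertex set \<open>V\<close> and its edge set \<open>E\<close>; isolated vertices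
  are allowed and count towards the number of vertices.\<close>

definition r_graph :: "nat \<Rightarrow> 'a set \<Rightarrow> 'a set set \<Rightarrow> bool" where
  "r_graph r V E \<longleftrightarrow> finite V \<and> (\<forall>e\<in>E. e \<subseteq> V \<and> card e = r)"

definition linear_r_graph :: "nat \<Rightarrow> 'a set \<Rightarrow> 'a set set \<Rightarrow> bool" where
  "linear_r_graph r V E \<longleftrightarrow>
     r_graph r V E \<and> (\<forall>e\<in>E. \<forall>f\<in>E. e \<noteq> f \<longrightarrow> card (e \<inter> f) \<le> 1)"

definition is_configuration :: "'a set set \<Rightarrow> nat \<Rightarrow> nat \<Rightarrow> 'a set set \<Rightarrow> bool" where
  "is_configuration E s t C \<longleftrightarrow> C \<subseteq> E \<and> finite C \<and> card C = t \<and> card (\<Union>C) \<le> s"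

definition lin_density :: "nat \<Rightarrow> 'a set \<Rightarrow> 'a set set \<Rightarrow> real" where
  "lin_density r V E = real (card E) * real (r choose 2) / real (card V choose 2)"

end

theory Submission
  imports Defs "HOL-Analysis.Convex"
begin

text \<open>Fix an edge \<open>e\<close> and distinct vertices \<open>x, y\<close> of it, and consider the bipartite graph \<open>H\<close> between
  the other edges through \<open>x\<close> and the other edges through \<open>y\<close>, where adjacency means intersecting.
  By linearity, adding a set \<open>S\<close> of vertices of \<open>H\<close> to \<open>e\<close> gives \<open>|S| + 1\<close> edges that span at most
  \<open>r + (r - 1) |S| - e\<^sub>H(S)\<close> vertices. So there is a \<open>((r - 2) k + 3, k)\<close>-configuration as soon as some
  \<open>k - 1\<close> vertices of \<open>H\<close> induce at least \<open>k - 2\<close> edges, and this is unavoidable once the number of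
  edges of \<open>H\<close> exceeds its number of vertices by \<open>(k - 1)\<^sup>2\<close>. On the other hand, an edge of \<open>H\<close> is
  essentially a common neighbour outside \<open>e\<close> of \<open>x\<close> and \<open>y\<close>. A vertex has \<open>\<epsilon>r\<close> neighbours on an
  average edge, so convexity yields, for some \<open>e, x, y\<close>, more edges in \<open>H\<close> than the
  allowed number if \<open>\<epsilon>r\<close> exceeds an absolute constant and \<open>n\<close> is large.\<close>

section \<open>Sparse induced subgraphs with almost as many edges as vertices\<close>

text \<open>Delete sets as long as the edge bound survives, then grow \<open>S\<close> from the
  empty set inside what remains. The slack \<open>m\<^sup>2\<close> does not change under deletion;
  it guarantees that at least \<open>m\<close> elements remain.\<close>

lemma dense_subset_of_size:
  fixes F :: "('b \<times> 'b) set"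
  assumes "finite W" "F \<subseteq> W \<times> W" "card W + m\<^sup>2 \<le> card F"
  shows "\<exists>S\<subseteq>W. card S = m \<and> m \<le> card (F \<inter> S \<times> S) + 1"
  using assms
proof (induction "card W" arbitrary: W F rule: less_induct)
  case less
  have finF: "finite F"
    using less.prems(1,2) finite_subset by blast
  \<comment> \<open>If no \<open>T\<close> can be deleted, every set \<open>T\<close> meets at least \<open>|T|\<close> pairs of \<open>F\<close>, so a set can always be
    enlarged by one element without losing the bound.\<close>
  show ?case
  proof (cases "\<exists>T\<subseteq>W. T \<noteq> {} \<and> card (W - T) + m\<^sup>2 \<le> card (F \<inter> (W - T) \<times> (W - T))")
    case True
    then obtain T where T: "T \<subseteq> W" "T \<noteq> {}"
      "card (W - T) + m\<^sup>2 \<le> card (F \<inter> (W - T) \<times> (W - T))" by blast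
    have "card (W - T) < card W"
      using T less.prems(1) by (intro psubset_card_mono) auto
    from less.hyps[OF this _ _ T(3)] less.prems(1) obtain S where
      S: "S \<subseteq> W - T" "card S = m" "m \<le> card ((F \<inter> (W - T) \<times> (W - T)) \<inter> S \<times> S) + 1"
      by auto
    have "(F \<inter> (W - T) \<times> (W - T)) \<inter> S \<times> S = F \<inter> S \<times> S"
      using S(1) by auto
    then show ?thesis using S by auto
  next
    case no_T: False
    \<comment> \<open>\<open>F\<close> has at most \<open>(card W)\<^sup>2\<close> pairs, so a
      smaller \<open>W\<close> could not hold \<open>m\<^sup>2\<close> of them.\<close>
    have mW: "m \<le> card W"
    proof (rule ccontr)
      assume "\<not> m \<le> card W"
      then have "(card W)\<^sup>2 < m\<^sup>2" by (simp add: power_strict_mono)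
      moreover have "card F \<le> (card W)\<^sup>2"
        using card_mono[of "W \<times> W" F] less.prems by (simp add: power2_eq_square card_cartesian_product)
      ultimately show False using less.prems(3) by linarith
    qed
    have "\<exists>S\<subseteq>W. card S = j \<and> j \<le> card (F \<inter> S \<times> S) + 1" if "j \<le> m" for j
      using that
    proof (induction j)
      case 0
      then show ?case by (intro exI[of _ "{}"]) auto
    next
      case (Suc j)
      then obtain S where S: "S \<subseteq> W" "card S = j" "j \<le> card (F \<inter> S \<times> S) + 1" by auto
      have finS: "finite S" using S(1) less.prems(1) finite_subset by blast
      have extend: ?case if "v \<in> W - S" "Suc j \<le> card (F \<inter> insert v S \<times> insert v S) + 1" for v
        using that S finS by (intro exI[of _ "insert v S"]) auto
      show ?case
      \<comment> \<open>If \<open>S\<close> has a pair to spare, any new element will do. Otherwise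
        fewer than \<open>j\<close> pairs lie inside \<open>S\<close>, while more than
        \<open>j\<close> meet it.\<close>
      proof (cases "j \<le> card (F \<inter> S \<times> S)")
        case True
        obtain v where v: "v \<in> W - S"
          using S(1,2) mW Suc.prems by (metis Diff_eq_empty_iff Suc_le_eq all_not_in_conv leD
              subset_antisym)
        have "card (F \<inter> S \<times> S) \<le> card (F \<inter> insert v S \<times> insert v S)"
          using finF by (intro card_mono) auto
        then show ?thesis using True by (intro extend[OF v]) linarith
      next
        case False
        then have "S \<noteq> {}" using S(2) by auto
        define D where "D = F \<inter> (W - S) \<times> (W - S)"
        have "card D < card (W - S) + m\<^sup>2"
          using no_T \<open>S \<noteq> {}\<close> S(1) unfolding D_def by (meson not_le)
        moreover have "card (W - S) = card W - j" "j \<le> card W"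
          using S(1,2) finS less.prems(1) by (auto simp: card_Diff_subset card_mono)
        ultimately have "card D + j < card F"
          using less.prems(3) by linarith
        then have "card D + card (F \<inter> S \<times> S) < card F" using False by linarith
        then have "\<not> F \<subseteq> D \<union> F \<inter> S \<times> S"
          using card_mono[of "D \<union> F \<inter> S \<times> S" F] card_Un_le[of D "F \<inter> S \<times> S"] finF
          by (metis D_def finite_Int finite_UnI le_trans not_le)
        \<comment> \<open>This pair meets \<open>S\<close> but is not inside it, so exactly one
          entry is outside \<open>S\<close>; adding that entry gains a pair.\<close>
        then obtain a b where ab: "(a, b) \<in> F" "(a, b) \<notin> D" "(a, b) \<notin> S \<times> S" by auto
        then obtain v where v: "v \<in> W - S" "a \<in> insert v S" "b \<in> insert v S"
          using less.prems(2) unfolding D_def by blast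
        have "card (insert (a, b) (F \<inter> S \<times> S)) \<le> card (F \<inter> insert v S \<times> insert v S)"
          using finF ab v by (intro card_mono) auto
        moreover have "card (insert (a, b) (F \<inter> S \<times> S)) = Suc (card (F \<inter> S \<times> S))"
          using ab finF by auto
        ultimately show ?thesis using S(3) by (intro extend[OF v(1)]) linarith
      qed
    qed
    then show ?thesis by blast
  qed
qed

section \<open>Linear hypergraphs: two vertices determine an edge\<close>

context
  fixes r :: nat and V :: "'a set" and E :: "'a set set"
  assumes lin: "linear_r_graph r V E"
begin

lemma finite_vertices: "finite V"
  using lin by (simp add: linear_r_graph_def r_graph_def)

lemma edge_subset: "e \<in> E \<Longrightarrow> e \<subseteq> V"
  using lin by (simp add: linear_r_graph_def r_graph_def)

lemma card_edge: "e \<in> E \<Longrightarrow> card e = r"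
  using lin by (simp add: linear_r_graph_def r_graph_def)

lemma finite_edge: "e \<in> E \<Longrightarrow> finite e"
  using edge_subset finite_vertices finite_subset by blast

lemma finite_edges: "finite E"
  using edge_subset finite_vertices by (meson PowI finite_Pow_iff finite_subset subsetI)

lemma edges_eqI:
  assumes "e \<in> E" "f \<in> E" "x \<in> e" "x \<in> f" "y \<in> e" "y \<in> f" "x \<noteq> y"
  shows "e = f"
proof (rule ccontr)
  assume "e \<noteq> f"
  then have "card (e \<inter> f) \<le> 1"
    using lin assms by (simp add: linear_r_graph_def)
  moreover have "card {x, y} \<le> card (e \<inter> f)"
    using assms finite_edge by (intro card_mono) auto
  ultimately show False using assms by simp
qed

section \<open>Configurations from intersecting edges through two vertices\<close>

definition other_edges :: "'a set \<Rightarrow> 'a \<Rightarrow> 'a set set" where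
  "other_edges e x = {a \<in> E. x \<in> a \<and> a \<noteq> e}"

lemma finite_other_edges: "finite (other_edges e x)"
  unfolding other_edges_def using finite_edges by simp

text \<open>The edge set of the bipartite graph \<open>H\<close>, each edge oriented from the side
  of \<open>x\<close> to the side of \<open>y\<close>.\<close>

definition crossing_pairs :: "'a set \<Rightarrow> 'a \<Rightarrow> 'a \<Rightarrow> ('a set \<times> 'a set) set" where
  "crossing_pairs e x y =
     {(a, b). a \<in> other_edges e x \<and> b \<in> other_edges e y \<and> a \<inter> b \<noteq> {}}"

text \<open>The edges in \<open>Y\<close> share \<open>y\<close>, which is not on \<open>a\<close>,
  so by linearity they meet \<open>a\<close> in distinct vertices. None of these is
  \<open>x\<close>, since only \<open>e\<close> contains both \<open>x\<close> and \<open>y\<close>.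
  With \<open>x\<close> this makes \<open>card Y + 1\<close> vertices of \<open>a\<close> inside
  \<open>U\<close>.\<close>

lemma card_new_vertices:
  assumes "e \<in> E" "x \<in> e" "y \<in> e" "x \<noteq> y" "a \<in> other_edges e x"
    and Y: "Y \<subseteq> {b \<in> other_edges e y. a \<inter> b \<noteq> {}}" and U: "\<Union>Y \<subseteq> U" "x \<in> U"
  shows "card (a - U) + card Y + 1 \<le> r"
proof -
  have a: "a \<in> E" "x \<in> a" "y \<notin> a" and fina: "finite a"
    using assms edges_eqI[of a e x y] finite_edge by (auto simp: other_edges_def)
  define p where "p b = (SOME v. v \<in> a \<inter> b)" for b
  have p: "p b \<in> a \<inter> b" if "b \<in> Y" for b
  proof -
    have "a \<inter> b \<noteq> {}" using that Y by blast
    then show ?thesis unfolding p_def by (rule some_in_eq[THEN iffD2])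
  qed
  have "inj_on p Y"
  proof (rule inj_onI)
    fix b c assume bc: "b \<in> Y" "c \<in> Y" "p b = p c"
    have "p b \<noteq> y" using p[OF bc(1)] a by auto
    then show "b = c"
      using edges_eqI[of b c "p b" y] bc p[of b] p[of c] Y by (auto simp: other_edges_def)
  qed
  have xY: "x \<notin> p ` Y"
  proof
    assume "x \<in> p ` Y"
    then obtain b where b: "b \<in> Y" "x \<in> b" using p by auto
    then show False using edges_eqI[of b e x y] assms Y by (auto simp: other_edges_def)
  qed
  have "finite Y" using Y finite_other_edges finite_subset by fastforce
  have "insert x (p ` Y) \<subseteq> a \<inter> U" using p U a by auto
  then have "card (insert x (p ` Y)) \<le> card (a \<inter> U)"
    using fina by (intro card_mono) auto
  then have "card Y + 1 \<le> card (a \<inter> U)"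
    using xY \<open>inj_on p Y\<close> \<open>finite Y\<close> by (simp add: card_image)
  moreover have "card (a - U) + card (a \<inter> U) = r"
    using card_Int_Diff[OF fina, of U] card_edge[OF a(1)] by simp
  ultimately show ?thesis by linarith
qed

lemma card_Union_crossing:
  assumes e: "e \<in> E" "x \<in> e" "y \<in> e" "x \<noteq> y"
    and S: "finite S" "S \<subseteq> other_edges e x \<union> other_edges e y"
  shows "card (\<Union>(insert e S)) + card (crossing_pairs e x y \<inter> S \<times> S) \<le> r + (r - 1) * card S"
  using S
proof (induction S)
  case empty
  then show ?case using card_edge e by simp
next
  case (insert a S)
  let ?F = "crossing_pairs e x y" and ?U = "\<Union>(insert e S)"
  have disj: "other_edges e x \<inter> other_edges e y = {}"
    using e edges_eqI by (fastforce simp: other_edges_def)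
  have "finite S" "a \<notin> S" using insert.hyps by auto
  \<comment> \<open>\<open>P\<close> contains the crossing pairs gained with \<open>a\<close>. As
    the two sides are disjoint, \<open>a\<close> occurs in them on one side only, and each of them
    saves a new vertex.\<close>
  obtain P where P: "card (a - ?U) + card P + 1 \<le> r" "finite P"
    "?F \<inter> insert a S \<times> insert a S \<subseteq> ?F \<inter> S \<times> S \<union> P"
  proof (cases "a \<in> other_edges e x")
    case True
    let ?Y = "{b \<in> S. b \<in> other_edges e y \<and> a \<inter> b \<noteq> {}}"
    have "card (a - ?U) + card ?Y + 1 \<le> r"
      using card_new_vertices[OF e True, of ?Y ?U] e by blast
    moreover have "card (Pair a ` ?Y) = card ?Y" by (intro card_image) (auto simp: inj_on_def)
    moreover have "?F \<inter> insert a S \<times> insert a S \<subseteq> ?F \<inter> S \<times> S \<union> Pair a ` ?Y"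
      using True disj by (auto simp: crossing_pairs_def)
    ultimately show thesis using that[of "Pair a ` ?Y"] \<open>finite S\<close> by simp
  next
    case False
    then have ay: "a \<in> other_edges e y" using insert.prems by auto
    let ?Y = "{b \<in> S. b \<in> other_edges e x \<and> a \<inter> b \<noteq> {}}" and ?g = "\<lambda>b. (b, a)"
    have "card (a - ?U) + card ?Y + 1 \<le> r"
      using card_new_vertices[OF e(1,3,2) _ ay, of ?Y ?U] e by blast
    moreover have "card (?g ` ?Y) = card ?Y" by (intro card_image) (auto simp: inj_on_def)
    moreover have "?F \<inter> insert a S \<times> insert a S \<subseteq> ?F \<inter> S \<times> S \<union> ?g ` ?Y"
      using False ay disj by (auto simp: crossing_pairs_def)
    ultimately show thesis using that[of "?g ` ?Y"] \<open>finite S\<close> by simp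
  qed
  have "card (?F \<inter> insert a S \<times> insert a S) \<le> card (?F \<inter> S \<times> S \<union> P)"
    using P \<open>finite S\<close> by (intro card_mono) auto
  also have "\<dots> \<le> card (?F \<inter> S \<times> S) + card P" by (rule card_Un_le)
  finally have F: "card (?F \<inter> insert a S \<times> insert a S) \<le> card (?F \<inter> S \<times> S) + card P" .
  have "\<Union>(insert e (insert a S)) = ?U \<union> (a - ?U)" by auto
  then have U: "card (\<Union>(insert e (insert a S))) \<le> card ?U + card (a - ?U)"
    by (metis card_Un_le)
  have "(r - 1) * card (insert a S) = (r - 1) * card S + (r - 1)"
    using \<open>finite S\<close> \<open>a \<notin> S\<close> by simp
  then show ?case using F U P(1) insert.IH insert.prems by simp
qed

lemma card_crossing_pairs_less:
  assumes e: "e \<in> E" "x \<in> e" "y \<in> e" "x \<noteq> y"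
    and "2 \<le> r" "0 < k" and free: "\<not> (\<exists>C. is_configuration E ((r - 2) * k + 3) k C)"
  shows "card (crossing_pairs e x y)
    < card (other_edges e x) + card (other_edges e y) + (k - 1)\<^sup>2"
proof (rule ccontr)
  let ?W = "other_edges e x \<union> other_edges e y"
  assume "\<not> ?thesis"
  then have "card ?W + (k - 1)\<^sup>2 \<le> card (crossing_pairs e x y)"
    using card_Un_le[of "other_edges e x" "other_edges e y"] by linarith
  moreover have "finite ?W" "crossing_pairs e x y \<subseteq> ?W \<times> ?W"
    using finite_other_edges by (auto simp: crossing_pairs_def)
  ultimately obtain S where S: "S \<subseteq> ?W" "card S = k - 1"
    "k - 1 \<le> card (crossing_pairs e x y \<inter> S \<times> S) + 1"
    by (metis dense_subset_of_size)
  have "finite S" using S(1) \<open>finite ?W\<close> finite_subset by blast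
  have "e \<notin> S" using S(1) by (auto simp: other_edges_def)
  \<comment> \<open>Avoids truncated subtraction in
    \<open>r + (r - 1) * (k - 1) - (k - 2) = (r - 2) * k + 3\<close>.\<close>
  obtain s j where s: "r = s + 2" "k = j + 1"
    using that[of "r - 2" "k - 1"] \<open>2 \<le> r\<close> \<open>0 < k\<close> by simp
  have "card (\<Union>(insert e S)) + j \<le> s + 2 + (s + 1) * j + 1"
    using card_Union_crossing[OF e \<open>finite S\<close> S(1)] S(2,3) s by simp
  then have "card (\<Union>(insert e S)) \<le> (r - 2) * k + 3"
    using s by (simp add: algebra_simps)
  then have "is_configuration E ((r - 2) * k + 3) k (insert e S)"
    using S \<open>finite S\<close> \<open>e \<notin> S\<close> e(1) \<open>0 < k\<close>
    by (auto simp: is_configuration_def other_edges_def)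
  then show False using free by blast
qed

section \<open>Double counting of neighbours around one edge\<close>

definition adjacent :: "'a \<Rightarrow> 'a \<Rightarrow> bool" where
  "adjacent w x \<longleftrightarrow> (\<exists>a\<in>E. w \<in> a \<and> x \<in> a)"

text \<open>A common neighbour \<open>w\<close> outside \<open>e\<close> lies on edges
  \<open>a\<close> through \<open>x\<close> and \<open>b\<close> through \<open>y\<close>. These
  differ, since otherwise both equal \<open>e\<close>, so \<open>w\<close> is the single element of
  \<open>a \<inter> b\<close> and is recovered from the pair.\<close>

lemma card_common_neighbours_le:
  assumes e: "e \<in> E" "x \<in> e" "y \<in> e" "x \<noteq> y"
  shows "card {w \<in> V - e. adjacent w x \<and> adjacent w y} \<le> card (crossing_pairs e x y)"
proof (rule surj_card_le)
  show "finite (crossing_pairs e x y)"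
    by (rule finite_subset[of _ "other_edges e x \<times> other_edges e y"])
      (auto simp: crossing_pairs_def finite_other_edges)
  show "{w \<in> V - e. adjacent w x \<and> adjacent w y}
      \<subseteq> (\<lambda>(a, b). the_elem (a \<inter> b)) ` crossing_pairs e x y"
  proof
    fix w assume "w \<in> {w \<in> V - e. adjacent w x \<and> adjacent w y}"
    then obtain a b where ab: "w \<notin> e" "a \<in> E" "b \<in> E" "w \<in> a" "x \<in> a" "w \<in> b" "y \<in> b"
      by (auto simp: adjacent_def)
    then have "a \<noteq> b" using edges_eqI[of a e x y] e by blast
    then have "a \<inter> b = {w}" using edges_eqI[of a b w] ab by blast
    moreover have "(a, b) \<in> crossing_pairs e x y"
      using ab by (auto simp: crossing_pairs_def other_edges_def)
    ultimately show "w \<in> (\<lambda>(a, b). the_elem (a \<inter> b)) ` crossing_pairs e x y"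
      by (intro image_eqI[of _ _ "(a, b)"]) auto
  qed
qed

lemma card_outer_neighbours:
  assumes e: "e \<in> E" "x \<in> e"
  shows "card {w \<in> V - e. adjacent w x} = (r - 1) * card (other_edges e x)"
proof -
  have "{w \<in> V - e. adjacent w x} = (\<Union>a\<in>other_edges e x. a - {x})"
    using e edge_subset edges_eqI by (fastforce simp: adjacent_def other_edges_def)
  also have "card \<dots> = (\<Sum>a\<in>other_edges e x. card (a - {x}))"
  proof (rule card_UN_disjoint)
    show "\<forall>a\<in>other_edges e x. \<forall>b\<in>other_edges e x. a \<noteq> b \<longrightarrow> (a - {x}) \<inter> (b - {x}) = {}"
      using edges_eqI by (fastforce simp: other_edges_def)
  qed (auto simp: finite_other_edges, auto simp: finite_edge other_edges_def)
  also have "\<dots> = (\<Sum>a\<in>other_edges e x. r - 1)"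
    by (intro sum.cong) (auto simp: other_edges_def card_edge)
  finally show ?thesis by simp
qed

text \<open>Compares the first two factorial moments of \<open>q\<close>, the number of neighbours
  in \<open>e\<close> of an outer vertex. The inequality \<open>5 * q \<le> q * (q - 1) + 9\<close>
  is \<open>(q - 3)\<^sup>2 \<ge> 0\<close>; the factor 3 is this slope 5 minus the 2 from the bound
  on crossing pairs.\<close>

lemma sum_other_edges_le:
  assumes e: "e \<in> E"
    and "2 \<le> r" "0 < k" and free: "\<not> (\<exists>C. is_configuration E ((r - 2) * k + 3) k C)"
  shows "3 * (r - 1) * (\<Sum>x\<in>e. card (other_edges e x))
    \<le> 9 * card V + r * (r - 1) * (k - 1)\<^sup>2"
proof -
  define c where "c x = card (other_edges e x)" for x
  define q where "q w = card {x \<in> e. adjacent w x}" for w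
  let ?P = "SIGMA x:e. e - {x}"
  have fe: "finite e" "card e = r" using e finite_edge card_edge by auto
  have fV: "finite (V - e)" using finite_vertices by simp
  have sum_q: "(\<Sum>w\<in>V - e. q w) = (r - 1) * (\<Sum>x\<in>e. c x)"
    unfolding q_def sum_distrib_left
    using fV fe card_outer_neighbours[OF e] by (intro sum_multicount_gen) (auto simp: c_def)
  have pairs: "card {p \<in> ?P. adjacent w (fst p) \<and> adjacent w (snd p)} = q w * (q w - 1)" for w
  proof -
    let ?Q = "{x \<in> e. adjacent w x}"
    have "{p \<in> ?P. adjacent w (fst p) \<and> adjacent w (snd p)} = (SIGMA x:?Q. ?Q - {x})" by auto
    also have "card \<dots> = (\<Sum>x\<in>?Q. card (?Q - {x}))"
      using fe by (intro card_SigmaI) auto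
    also have "\<dots> = (\<Sum>x\<in>?Q. q w - 1)"
      using fe by (intro sum.cong) (auto simp: q_def)
    finally show ?thesis by (simp add: q_def)
  qed
  \<comment> \<open>Counts outer vertices together with an ordered pair of distinct neighbours in
    \<open>e\<close>, by vertex and by pair.\<close>
  have "(\<Sum>w\<in>V - e. q w * (q w - 1))
      = (\<Sum>(x, y)\<in>?P. card {w \<in> V - e. adjacent w x \<and> adjacent w y})"
  proof -
    have "(\<Sum>w\<in>V - e. card {p \<in> ?P. adjacent w (fst p) \<and> adjacent w (snd p)})
      = (\<Sum>p\<in>?P. card {w \<in> V - e. adjacent w (fst p) \<and> adjacent w (snd p)})"
      using fV fe by (intro sum_multicount_gen) auto
    then show ?thesis unfolding pairs by (simp only: case_prod_unfold)
  qed
  also have "\<dots> \<le> (\<Sum>(x, y)\<in>?P. c x + c y + (k - 1)\<^sup>2)"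
  proof (rule sum_mono)
    fix p assume "p \<in> ?P"
    then obtain x y where p: "p = (x, y)" "x \<in> e" "y \<in> e" "x \<noteq> y" by auto
    show "(case p of (x, y) \<Rightarrow> card {w \<in> V - e. adjacent w x \<and> adjacent w y})
        \<le> (case p of (x, y) \<Rightarrow> c x + c y + (k - 1)\<^sup>2)"
      using card_common_neighbours_le[OF e p(2-4)] card_crossing_pairs_less[OF e p(2-4) assms(2-4)]
      unfolding p(1) c_def prod.case by linarith
  qed
  also have "\<dots> = 2 * (r - 1) * (\<Sum>x\<in>e. c x) + r * (r - 1) * (k - 1)\<^sup>2"
  proof -
    have fst: "(\<Sum>(x, y)\<in>?P. c x) = (r - 1) * (\<Sum>x\<in>e. c x)"
      using fe by (simp add: sum.Sigma[symmetric] sum_distrib_left)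
    have "(\<Sum>(x, y)\<in>?P. c y) = (\<Sum>(x, y)\<in>?P. c x)"
      by (rule sum.reindex_bij_witness[of _ prod.swap prod.swap]) auto
    moreover have "(\<Sum>(x, y)\<in>?P. (k - 1)\<^sup>2) = r * (r - 1) * (k - 1)\<^sup>2"
      using fe by (simp add: sum.Sigma[symmetric])
    ultimately show ?thesis
      using fst by (simp add: case_prod_unfold sum.distrib)
  qed
  finally have upper: "(\<Sum>w\<in>V - e. q w * (q w - 1))
    \<le> 2 * (r - 1) * (\<Sum>x\<in>e. c x) + r * (r - 1) * (k - 1)\<^sup>2" .
  \<comment> \<open>Linearises \<open>q (q - 1)\<close> with a slope that beats the factor 2 in \<open>upper\<close>.\<close>
  have "5 * t \<le> t * (t - 1) + 9" for t :: nat
  proof (cases "t \<le> 5")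
    case True
    then have "t \<in> {0, 1, 2, 3, 4, 5}" by auto
    then show ?thesis by auto
  next
    case False
    then have "t * 5 \<le> t * (t - 1)" by (intro mult_le_mono) auto
    then show ?thesis by linarith
  qed
  then have "(\<Sum>w\<in>V - e. 5 * q w) \<le> (\<Sum>w\<in>V - e. q w * (q w - 1) + 9)"
    by (intro sum_mono)
  then have "5 * ((r - 1) * (\<Sum>x\<in>e. c x)) \<le> (\<Sum>w\<in>V - e. q w * (q w - 1)) + 9 * card (V - e)"
    by (simp add: sum.distrib sum_q flip: sum_distrib_left)
  moreover have "card (V - e) \<le> card V"
    using finite_vertices by (intro card_mono) auto
  ultimately show ?thesis
    using upper unfolding c_def mult.assoc by linarith
qed

section \<open>From the local bound to a bound on the number of edges\<close>

text \<open>Summing the local bound over all edges weights each vertex by its degree, which gives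
  the sum of squared degrees; Cauchy-Schwarz bounds this below through the degree sum
  \<open>m * r\<close>.\<close>

lemma card_edges_upper_bound:
  assumes "2 \<le> r" "0 < k" and free: "\<not> (\<exists>C. is_configuration E ((r - 2) * k + 3) k C)"
  shows "3 * (real r - 1) * r * (real r * card E - card V)
    \<le> card V * (9 * real (card V) + r * (real r - 1) * (real k - 1)\<^sup>2)"
proof (cases "E = {}")
  case False
  define n where "n = real (card V)"
  define m where "m = real (card E)"
  define B where "B = 9 * n + r * (real r - 1) * (real k - 1)\<^sup>2"
  define d where "d x = real (card {a \<in> E. x \<in> a})" for x
  have m: "0 < m" using False finite_edges by (simp add: m_def card_gt_0_iff)
  have r: "0 \<le> real r - 1" using \<open>2 \<le> r\<close> by simp
  have V_edge: "{x \<in> V. x \<in> e} = e" if "e \<in> E" for e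
    using edge_subset[OF that] by auto
  have "(\<Sum>e\<in>E. real (card {x \<in> V. x \<in> e})) = (\<Sum>x\<in>V. d x)"
    using sum_multicount_gen[OF finite_edges finite_vertices, of "\<lambda>e x. x \<in> e" "\<lambda>x. card {a \<in> E. x \<in> a}"]
    unfolding d_def by (simp flip: of_nat_sum)
  then have sum_d: "(\<Sum>x\<in>V. d x) = m * r"
    using V_edge card_edge by (simp add: m_def)
  have "(\<Sum>e\<in>E. \<Sum>x\<in>{x \<in> V. x \<in> e}. d x) = (\<Sum>x\<in>V. \<Sum>e\<in>{e \<in> E. x \<in> e}. d x)"
    using finite_edges finite_vertices by (rule sum.swap_restrict)
  then have sum_edges_d: "(\<Sum>e\<in>E. \<Sum>x\<in>e. d x) = (\<Sum>x\<in>V. (d x)\<^sup>2)"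
    using V_edge by (simp add: d_def power2_eq_square)
  \<comment> \<open>The degrees also count \<open>e\<close> itself, once for each of its
    \<open>r\<close> vertices.\<close>
  have local_bound: "3 * (real r - 1) * ((\<Sum>x\<in>e. d x) - r) \<le> B" if e: "e \<in> E" for e
  proof -
    have "real (card (other_edges e x)) = d x - 1" if "x \<in> e" for x
    proof -
      have "{a \<in> E. x \<in> a} = insert e (other_edges e x)"
        using e that by (auto simp: other_edges_def)
      moreover have "e \<notin> other_edges e x" by (simp add: other_edges_def)
      ultimately show ?thesis unfolding d_def using finite_other_edges by simp
    qed
    then have "(\<Sum>x\<in>e. real (card (other_edges e x))) = (\<Sum>x\<in>e. d x) - r"
      using card_edge[OF e] by (simp add: sum_subtractf)
    moreover have "real (3 * (r - 1) * (\<Sum>x\<in>e. card (other_edges e x)))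
        \<le> real (9 * card V + r * (r - 1) * (k - 1)\<^sup>2)"
      using sum_other_edges_le[OF e assms] by (intro of_nat_mono)
    ultimately show ?thesis
      using assms(1,2) by (simp add: B_def n_def of_nat_diff)
  qed
  \<comment> \<open>The extra factor \<open>m\<close> stands for the sum over edges and is cancelled
    at the end.\<close>
  have "m * (3 * (real r - 1) * (m * r * r - n * r)) = 3 * (real r - 1) * ((m * r)\<^sup>2 - n * (m * r))"
    by (simp add: algebra_simps power2_eq_square)
  also have "\<dots> \<le> 3 * (real r - 1) * (n * (\<Sum>x\<in>V. (d x)\<^sup>2) - n * (m * r))"
    using sum_squared_le_sum_of_squares[of d V] sum_d r
    by (intro mult_left_mono) (auto simp: n_def mult.commute)
  also have "\<dots> = n * (\<Sum>e\<in>E. 3 * (real r - 1) * ((\<Sum>x\<in>e. d x) - r))"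
    unfolding sum_distrib_left[symmetric] sum_subtractf sum_edges_d
    by (simp add: m_def algebra_simps)
  also have "\<dots> \<le> n * (\<Sum>e\<in>E. B)"
    using local_bound by (intro mult_left_mono sum_mono) (auto simp: n_def)
  also have "\<dots> = m * (n * B)"
    by (simp add: m_def)
  finally have "3 * (real r - 1) * (m * r * r - n * r) \<le> n * B"
    using m by simp
  then show ?thesis by (simp add: B_def n_def m_def algebra_simps)
next
  case True
  then have "3 * (real r - 1) * r * (real r * card E - card V) \<le> 0"
    using \<open>2 \<le> r\<close> by (simp add: mult_nonneg_nonpos)
  also have "\<dots> \<le> card V * (9 * real (card V) + r * (real r - 1) * (real k - 1)\<^sup>2)"
    using \<open>2 \<le> r\<close> by simp
  finally show ?thesis .
qed

end

section \<open>Choice of the thresholds\<close>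

theorem theorem3:
  shows "\<forall>\<epsilon>::real. \<epsilon> > 0 \<longrightarrow>
    (\<exists>r0::nat. \<forall>r\<ge>r0. \<forall>k\<ge>3. \<exists>n0::nat.
      \<forall>(V::'a set) E. linear_r_graph r V E \<longrightarrow> card V \<ge> n0 \<longrightarrow>
        \<not> (\<exists>C. is_configuration E ((r - 2) * k + 3) k C) \<longrightarrow>
        lin_density r V E < \<epsilon>)"
proof (intro allI impI)
  fix \<epsilon> :: real assume "\<epsilon> > 0"
  \<comment> \<open>With \<open>r * \<epsilon> \<ge> 6\<close> the edge bound has a main term of at
    least \<open>18 * n * (n - 1)\<close> on the left against \<open>9 * n * n\<close> on the
    right.\<close>
  define r0 where "r0 = max 2 (nat \<lceil>6 / \<epsilon>\<rceil>)"
  have "lin_density r V E < \<epsilon>"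
    if r: "r0 \<le> r" and k: "3 \<le> k" and lin: "linear_r_graph r V E"
      and V: "r * (r - 1) * ((k - 1)\<^sup>2 + 3) + 3 \<le> card V"
      and free: "\<not> (\<exists>C. is_configuration E ((r - 2) * k + 3) k C)"
    for r k :: nat and V :: "'a set" and E
  proof (rule ccontr)
    assume "\<not> lin_density r V E < \<epsilon>"
    define n where "n = real (card V)"
    define m where "m = real (card E)"
    define K where "K = (real k - 1)\<^sup>2"
    have r2: "2 \<le> r" and "6 / \<epsilon> \<le> r" using r by (auto simp: r0_def)
    then have r\<epsilon>: "6 \<le> r * \<epsilon>" using \<open>\<epsilon> > 0\<close> by (simp add: field_simps)
    have "real (r * (r - 1) * ((k - 1)\<^sup>2 + 3) + 3) \<le> n"
      using V unfolding n_def by (rule of_nat_mono)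
    then have nK: "r * (real r - 1) * (K + 3) + 3 \<le> n"
      using r2 k by (simp add: K_def of_nat_diff)
    have "0 \<le> r * (real r - 1) * (K + 3)" using r2 by (auto simp: K_def intro!: mult_nonneg_nonneg)
    then have n: "3 \<le> n" using nK by linarith
    have choose: "real (j choose 2) = j * (real j - 1) / 2" for j
      by (cases j) (auto simp: choose_two real_of_nat_div algebra_simps)
    \<comment> \<open>Here \<open>n \<ge> 3\<close> makes the denominator positive; for
      \<open>n \<le> 1\<close> the quotient would be 0 by convention.\<close>
    have "\<epsilon> * (n * (n - 1)) \<le> m * (r * (real r - 1))"
      using \<open>\<not> lin_density r V E < \<epsilon>\<close> n
      by (simp add: lin_density_def choose n_def m_def field_simps)
    then have "3 * r * (\<epsilon> * (n * (n - 1))) \<le> 3 * r * (m * (r * (real r - 1)))"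
      by (intro mult_left_mono) auto
    moreover have "6 * (n * (n - 1)) \<le> r * \<epsilon> * (n * (n - 1))"
      using r\<epsilon> n by (intro mult_right_mono) auto
    moreover have "3 * (real r - 1) * r * (r * m - n) \<le> n * (9 * n + r * (real r - 1) * K)"
      using card_edges_upper_bound[OF lin r2 _ free] k unfolding n_def m_def K_def by simp
    ultimately have "n * (18 * (n - 1) - 3 * r * (real r - 1)) \<le> n * (9 * n + r * (real r - 1) * K)"
      by (simp add: algebra_simps)
    then have "18 * (n - 1) - 3 * r * (real r - 1) \<le> 9 * n + r * (real r - 1) * K"
      using n by simp
    \<comment> \<open>The inequality gives \<open>9 * n \<le> 18 + r * (r - 1) * (K + 3)\<close>,
      hence \<open>9 * n \<le> n + 15\<close> by the choice of the threshold for \<open>n\<close>,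
      against \<open>n \<ge> 3\<close>.\<close>
    then show False using nK n by (simp add: algebra_simps)
  qed
  then show "\<exists>r0::nat. \<forall>r\<ge>r0. \<forall>k\<ge>3. \<exists>n0::nat.
      \<forall>(V::'a set) E. linear_r_graph r V E \<longrightarrow> card V \<ge> n0 \<longrightarrow>
        \<not> (\<exists>C. is_configuration E ((r - 2) * k + 3) k C) \<longrightarrow>
        lin_density r V E < \<epsilon>"
    by metis
qed

end
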